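(* Let $G$ be a finite simple graph with at least two vertices that has a perfect matching consisting only of pendant edges. Then $G$ is $\alpha^{++}$-stable if and only if $G$ contains no cycle on $4$ vertices (that is, no four vertices of $G$ span a subgraph containing a cycle of length $4$).
   Context: $\alpha(G)$ is the maximum size of a stable set of $G$. A pendant edge is an edge $vw$ such that $v$ has exactly one neighbour. For $e\in E(\overline{G})$ (a pair of distinct non-adjacent vertices), $G+e$ denotes $G$ with the edge $e$ added. $G$ is $\alpha^{++}$-stable if $\alpha(G+e_1+e_2)=\alpha(G)$ for any $e_1,e_2\in E(\overline{G})$ (not necessarily distinct). *)

theory Defs
  imports "Graph_Theory.Pair_Digraph"
begin

text \<open>A finite simple graph is a \<^locale>\<open>pair_graph\<close>: a finite, loop-free, symmetric relation
  on a vertex set. An undirected edge is the two-element set of its endpoints, so it corresponds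
  to the two arcs joining them.\<close>

definition edge_set :: "'a pair_pre_digraph \<Rightarrow> 'a set set" where
  "edge_set G = {{u, v} | u v. (u, v) \<in> parcs G}"

definition complement_edge_set :: "'a pair_pre_digraph \<Rightarrow> 'a set set" where
  "complement_edge_set G =
     {{u, v} | u v. u \<in> pverts G \<and> v \<in> pverts G \<and> u \<noteq> v \<and> (u, v) \<notin> parcs G}"

definition add_edge :: "'a pair_pre_digraph \<Rightarrow> 'a set \<Rightarrow> 'a pair_pre_digraph" where
  "add_edge G e = \<lparr> pverts = pverts G, parcs = parcs G \<union> {(u, v). {u, v} = e} \<rparr>"

definition neighbours :: "'a pair_pre_digraph \<Rightarrow> 'a \<Rightarrow> 'a set" where
  "neighbours G v = {w. (v, w) \<in> parcs G}"

definition stable_set :: "'a pair_pre_digraph \<Rightarrow> 'a set \<Rightarrow> bool" where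
  "stable_set G S \<longleftrightarrow> S \<subseteq> pverts G \<and> (\<forall>u\<in>S. \<forall>v\<in>S. (u, v) \<notin> parcs G)"

definition stability_number :: "'a pair_pre_digraph \<Rightarrow> nat" where
  "stability_number G = Max (card ` {S. stable_set G S})"

definition perfect_matching :: "'a pair_pre_digraph \<Rightarrow> 'a set set \<Rightarrow> bool" where
  "perfect_matching G M \<longleftrightarrow> M \<subseteq> edge_set G \<and> pairwise disjnt M \<and> \<Union> M = pverts G"

definition pendant_edge :: "'a pair_pre_digraph \<Rightarrow> 'a set \<Rightarrow> bool" where
  "pendant_edge G e \<longleftrightarrow> e \<in> edge_set G \<and> (\<exists>v\<in>e. card (neighbours G v) = 1)"

text \<open>Both added edges are taken from the complement of \<open>G\<close> itself; they may coincide, since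
  \<^const>\<open>add_edge\<close> is idempotent.\<close>

definition alpha_plus_plus_stable :: "'a pair_pre_digraph \<Rightarrow> bool" where
  "alpha_plus_plus_stable G \<longleftrightarrow>
     (\<forall>e1 \<in> complement_edge_set G. \<forall>e2 \<in> complement_edge_set G.
        stability_number (add_edge (add_edge G e1) e2) = stability_number G)"

text \<open>A \<^const>\<open>pre_digraph.cycle\<close> of a symmetric digraph may be a back-and-forth walk along one
  edge, but only at length 2; those of length at least 3 are exactly the cycles of the undirected
  graph.\<close>

definition has_cycle_of_length :: "'a pair_pre_digraph \<Rightarrow> nat \<Rightarrow> bool" where
  "has_cycle_of_length G n \<longleftrightarrow> (\<exists>p. pre_digraph.cycle (with_proj G) p \<and> length p = n)"

end

theory Submission
  imports Defs
begin

text \<open>Every stable set has at most one vertex in each edge of the matching, so the stability number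
  is the number of matching edges, and the maximum stable sets pick one endpoint from each of them.
  Adding the pairs \<open>e1\<close> and \<open>e2\<close> lowers the stability number iff every maximum stable set contains
  one of the two. Testing this on the set of all leaves and on the sets in which one or two leaves
  are replaced by their neighbours shows that \<open>e1\<close> and \<open>e2\<close> consist of the leaves at four vertices
  \<open>a, b\<close> and \<open>c, d\<close>, and that both \<open>a\<close> and \<open>b\<close> are adjacent to both \<open>c\<close> and \<open>d\<close>. Conversely, for a
  4-cycle \<open>a, c, b, d\<close> joining the leaves at \<open>a, b\<close> and those at \<open>c, d\<close> forces a maximum stable set
  to contain two adjacent vertices of the cycle.\<close>

section \<open>Added edges and 4-cycles in terms of arcs\<close>

lemma stable_set_add_edge:
  assumes "e = {u, v}"
  shows "stable_set (add_edge G e) S \<longleftrightarrow> stable_set G S \<and> \<not> e \<subseteq> S"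
proof
  assume "stable_set (add_edge G e) S"
  then show "stable_set G S \<and> \<not> e \<subseteq> S"
    using assms unfolding stable_set_def add_edge_def by auto
next
  assume "stable_set G S \<and> \<not> e \<subseteq> S"
  then show "stable_set (add_edge G e) S"
    unfolding stable_set_def add_edge_def by auto
qed

text \<open>Trades the arc-list cycles of the library for four named vertices, the form in which
  both directions of the theorem handle a 4-cycle.\<close>

lemma has_cycle_of_length_4_iff:
  assumes "pair_graph G"
  shows "has_cycle_of_length G 4 \<longleftrightarrow>
    (\<exists>a b c d. distinct [a, b, c, d] \<and> {(a, b), (b, c), (c, d), (d, a)} \<subseteq> parcs G)"
proof
  assume "has_cycle_of_length G 4"
  then obtain p where p: "pre_digraph.cycle (with_proj G) p" "length p = 4"
    by (auto simp: has_cycle_of_length_def)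
  from p(2) obtain a a' b b' c c' d d' where p_eq: "p = [(a, a'), (b, b'), (c, c'), (d, d')]"
    by (auto simp: numeral_eq_Suc length_Suc_conv)
  from p(1) obtain u where u: "pre_digraph.awalk (with_proj G) u p u"
    "distinct (tl (pre_digraph.awalk_verts (with_proj G) u p))"
    by (auto simp: pre_digraph.cycle_def)
  \<comment> \<open>The closed walk identifies the head of each arc with the tail of the next,
    cyclically; the tail of its vertex list is then \<open>[b, c, d, a]\<close>.\<close>
  have "{(a, b), (b, c), (c, d), (d, a)} \<subseteq> parcs G" and "distinct [a, b, c, d]"
    using u by (simp_all add: p_eq pre_digraph.awalk_def pre_digraph.cas.simps
        pre_digraph.awalk_verts.simps) blast+
  then show "\<exists>a b c d. distinct [a, b, c, d] \<and> {(a, b), (b, c), (c, d), (d, a)} \<subseteq> parcs G"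
    by blast
next
  interpret pair_graph G by fact
  assume "\<exists>a b c d. distinct [a, b, c, d] \<and> {(a, b), (b, c), (c, d), (d, a)} \<subseteq> parcs G"
  then obtain a b c d where abcd: "distinct [a, b, c, d]"
    "{(a, b), (b, c), (c, d), (d, a)} \<subseteq> parcs G"
    by blast
  moreover have "a \<in> pverts G" using abcd(2) by (auto dest: in_arcsD1)
  ultimately have "pre_digraph.cycle (with_proj G) [(a, b), (b, c), (c, d), (d, a)]"
    unfolding pre_digraph.cycle_def pre_digraph.awalk_def
    by (intro exI[of _ a])
       (simp add: pre_digraph.cas.simps pre_digraph.awalk_verts.simps eq_commute)
  then show "has_cycle_of_length G 4"
    unfolding has_cycle_of_length_def by force
qed

text \<open>Fixes an orientation of each matching edge. If both endpoints of an edge have degree 1,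
  either may serve as \<open>leaf\<close>.\<close>

locale pendant_matching = pair_graph G for G :: "'a pair_pre_digraph" +
  fixes M :: "'a set set" and leaf stem :: "'a set \<Rightarrow> 'a"
  assumes edge_eq: "e \<in> M \<Longrightarrow> e = {leaf e, stem e}"
    and leaf_neighbour_iff: "e \<in> M \<Longrightarrow> (leaf e, w) \<in> parcs G \<longleftrightarrow> w = stem e"
    and disjoint: "pairwise disjnt M"
    and cover: "\<Union> M = pverts G"
begin

lemma finite_matching: "finite M"
  using cover finite_verts by (metis finite_UnionD)

lemma leaf_stem_in: "e \<in> M \<Longrightarrow> leaf e \<in> e" "e \<in> M \<Longrightarrow> stem e \<in> e"
  using edge_eq by (metis insertI1, metis insertI1 insert_commute)

lemma in_edge_iff: "e \<in> M \<Longrightarrow> x \<in> e \<longleftrightarrow> x = leaf e \<or> x = stem e"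
  using edge_eq by (metis insert_iff singletonD)

lemma edges_eqI: "e \<in> M \<Longrightarrow> e' \<in> M \<Longrightarrow> x \<in> e \<Longrightarrow> x \<in> e' \<Longrightarrow> e = e'"
  using disjoint by (metis disjnt_iff pairwiseD)

lemma in_verts: "e \<in> M \<Longrightarrow> leaf e \<in> pverts G" "e \<in> M \<Longrightarrow> stem e \<in> pverts G"
  using cover leaf_stem_in by blast+

lemma leaf_eq_iff: "e \<in> M \<Longrightarrow> e' \<in> M \<Longrightarrow> leaf e = leaf e' \<longleftrightarrow> e = e'"
  using edges_eqI leaf_stem_in by metis

lemma arc_sym: "(u, v) \<in> parcs G \<Longrightarrow> (v, u) \<in> parcs G"
  using arcs_symmetric by blast

lemma no_loop: "(v, v) \<notin> parcs G"
  using no_loops by fastforce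

lemma leaf_neq_stem: "e \<in> M \<Longrightarrow> e' \<in> M \<Longrightarrow> leaf e \<noteq> stem e'"
proof
  assume e: "e \<in> M" "e' \<in> M" "leaf e = stem e'"
  then have "e = e'" using edges_eqI leaf_stem_in by metis
  with e show False using leaf_neighbour_iff[of e "stem e"] no_loop by metis
qed

lemma stem_eq_iff: "e \<in> M \<Longrightarrow> e' \<in> M \<Longrightarrow> stem e = stem e' \<longleftrightarrow> e = e'"
  using edges_eqI leaf_stem_in by metis

section \<open>Maximum stable sets as transversals of the matching\<close>

text \<open>The endpoints of a matching edge are adjacent, so a stable set meets the edge in at most
  one vertex. As \<open>M\<close> covers all vertices, sending each edge that is met to its common
  vertex with \<open>S\<close> is a bijection onto \<open>S\<close>.\<close>

lemma card_stable_set: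
  assumes "stable_set G S"
  shows "card S = card {e \<in> M. e \<inter> S \<noteq> {}}"
proof -
  have "\<exists>x. e \<inter> S = {x}" if e: "e \<in> M" "e \<inter> S \<noteq> {}" for e
  proof -
    have "\<not> (leaf e \<in> S \<and> stem e \<in> S)"
      using assms leaf_neighbour_iff[OF e(1)] by (auto simp: stable_set_def)
    moreover obtain x where "x \<in> e" "x \<in> S" using e(2) by blast
    ultimately show ?thesis
      by (intro exI[of _ x]) (auto simp: in_edge_iff[OF e(1)])
  qed
  then obtain pick where pick: "\<And>e. e \<in> M \<Longrightarrow> e \<inter> S \<noteq> {} \<Longrightarrow> e \<inter> S = {pick e}"
    by metis
  have "bij_betw pick {e \<in> M. e \<inter> S \<noteq> {}} S"
  proof (rule bij_betwI')
    fix e e' assume "e \<in> {e \<in> M. e \<inter> S \<noteq> {}}" "e' \<in> {e \<in> M. e \<inter> S \<noteq> {}}"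
    then show "(pick e = pick e') = (e = e')"
      using pick edges_eqI by (metis (mono_tags, lifting) IntD1 insertI1 mem_Collect_eq)
  next
    fix e assume "e \<in> {e \<in> M. e \<inter> S \<noteq> {}}"
    then show "pick e \<in> S" using pick by blast
  next
    fix x assume "x \<in> S"
    then obtain e where "e \<in> M" "x \<in> e" using assms cover unfolding stable_set_def by blast
    then show "\<exists>e\<in>{e \<in> M. e \<inter> S \<noteq> {}}. x = pick e" using pick \<open>x \<in> S\<close> by blast
  qed
  then show ?thesis using bij_betw_same_card by metis
qed

lemma card_stable_set_le: "stable_set G S \<Longrightarrow> card S \<le> card M"
  by (simp add: card_stable_set card_mono finite_matching)

lemma card_stable_set_eq_iff:
  assumes "stable_set G S"
  shows "card S = card M \<longleftrightarrow> (\<forall>e\<in>M. leaf e \<in> S \<or> stem e \<in> S)"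
proof -
  have "card S = card M \<longleftrightarrow> {e \<in> M. e \<inter> S \<noteq> {}} = M"
    using card_stable_set[OF assms] finite_matching
    by (metis (no_types, lifting) card_subset_eq mem_Collect_eq subsetI)
  also have "\<dots> \<longleftrightarrow> (\<forall>e\<in>M. e \<inter> S \<noteq> {})" by blast
  also have "\<dots> \<longleftrightarrow> (\<forall>e\<in>M. leaf e \<in> S \<or> stem e \<in> S)"
  proof (rule ball_cong[OF refl])
    fix e assume "e \<in> M"
    then show "e \<inter> S \<noteq> {} \<longleftrightarrow> leaf e \<in> S \<or> stem e \<in> S"
      by (auto simp: in_edge_iff ex_in_conv[symmetric])
  qed
  finally show ?thesis .
qed

text \<open>The bound \<open>card M\<close> carries over from \<open>G\<close> to \<open>H\<close>,
  so the maximum equals it iff it is attained. Used for \<open>G\<close> itself and for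
  \<open>G\<close> with two added edges.\<close>

lemma stability_number_supergraph_iff:
  assumes "\<And>S. stable_set H S \<Longrightarrow> stable_set G S"
  shows "stability_number H = card M \<longleftrightarrow> (\<exists>S. stable_set H S \<and> card S = card M)"
proof -
  have fin: "finite (card ` {S. stable_set H S})"
    by (rule finite_surj[of "{.. card M}" _ id]) (use assms card_stable_set_le in auto)
  have "stable_set H {}" by (auto simp: stable_set_def)
  then have ne: "card ` {S. stable_set H S} \<noteq> {}" by blast
  have "stability_number H = card M \<longleftrightarrow> card M \<in> card ` {S. stable_set H S}"
    unfolding stability_number_def Max_eq_iff[OF fin ne]
    using assms card_stable_set_le by blast
  then show ?thesis by (auto simp: eq_commute)
qed

section \<open>Test sets obtained from the set of all leaves\<close>

text \<open>A transversal of \<open>M\<close>: the set of all leaves, with the leaves of the edges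
  in \<open>A\<close> replaced by their stems.\<close>

definition exchange :: "'a set set \<Rightarrow> 'a set" where
  "exchange A = stem ` A \<union> leaf ` (M - A)"

lemma stem_in_exchange_iff:
  assumes "A \<subseteq> M" "e \<in> M"
  shows "stem e \<in> exchange A \<longleftrightarrow> e \<in> A"
proof -
  have "stem e \<in> stem ` A \<longleftrightarrow> e \<in> A" using assms stem_eq_iff by (metis image_iff subsetD)
  moreover have "stem e \<notin> leaf ` (M - A)" using leaf_neq_stem[OF _ assms(2)] by fastforce
  ultimately show ?thesis by (simp add: exchange_def)
qed

lemma leaf_in_exchange_iff:
  assumes "A \<subseteq> M" "e \<in> M"
  shows "leaf e \<in> exchange A \<longleftrightarrow> e \<notin> A"
proof -
  have "leaf e \<in> leaf ` (M - A) \<longleftrightarrow> e \<notin> A" using assms leaf_eq_iff by (metis Diff_iff image_iff)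
  moreover have "leaf e \<notin> stem ` A" using assms leaf_neq_stem[OF assms(2)] by (metis imageE subsetD)
  ultimately show ?thesis by (simp add: exchange_def)
qed

text \<open>The only neighbour of a leaf is its own stem, which is never chosen together with it, so
  any conflict is between two stems of \<open>A\<close>.\<close>

lemma stable_set_exchange:
  assumes "A \<subseteq> M" and "\<And>a b. a \<in> A \<Longrightarrow> b \<in> A \<Longrightarrow> (stem a, stem b) \<notin> parcs G"
  shows "stable_set G (exchange A)"
  unfolding stable_set_def
proof (intro conjI ballI)
  show "exchange A \<subseteq> pverts G"
    using assms(1) in_verts by (auto simp: exchange_def)
  have leaf: "(leaf e, w) \<notin> parcs G" if "e \<in> M - A" "w \<in> exchange A" for e w
  proof -
    have "w \<noteq> stem e" using that stem_in_exchange_iff[OF assms(1), of e] by auto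
    then show ?thesis using that leaf_neighbour_iff by blast
  qed
  fix u v assume uv: "u \<in> exchange A" "v \<in> exchange A"
  show "(u, v) \<notin> parcs G"
  proof (cases "u \<in> stem ` A \<and> v \<in> stem ` A")
    case True
    then show ?thesis using assms(2) by blast
  next
    case False
    then show ?thesis using uv leaf arc_sym by (auto simp: exchange_def)
  qed
qed

lemma card_exchange:
  assumes "A \<subseteq> M" "stable_set G (exchange A)"
  shows "card (exchange A) = card M"
  unfolding card_stable_set_eq_iff[OF assms(2)] by (auto simp: exchange_def)

lemma stability_number_eq: "stability_number G = card M"
  using stability_number_supergraph_iff[of G] stable_set_exchange[of "{}"] card_exchange[of "{}"]
  by auto

lemma stability_number_add_two_edges_iff:
  assumes "e1 \<in> complement_edge_set G" "e2 \<in> complement_edge_set G"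
  shows "stability_number (add_edge (add_edge G e1) e2) = stability_number G \<longleftrightarrow>
    (\<exists>S. stable_set G S \<and> card S = card M \<and> \<not> e1 \<subseteq> S \<and> \<not> e2 \<subseteq> S)"
proof -
  from assms obtain u v u' v' where "e1 = {u, v}" "e2 = {u', v'}"
    by (auto simp: complement_edge_set_def)
  then have "stable_set (add_edge (add_edge G e1) e2) S \<longleftrightarrow>
      stable_set G S \<and> \<not> e1 \<subseteq> S \<and> \<not> e2 \<subseteq> S" for S
    by (simp add: stable_set_add_edge)
  then show ?thesis
    using stability_number_supergraph_iff[of "add_edge (add_edge G e1) e2"] stability_number_eq
    by auto
qed

lemma leaf_pair_complement_edge:
  assumes "a \<in> M" "b \<in> M" "a \<noteq> b"
  shows "{leaf a, leaf b} \<in> complement_edge_set G"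
proof -
  have "leaf a \<noteq> leaf b" "(leaf a, leaf b) \<notin> parcs G"
    using assms leaf_eq_iff leaf_neighbour_iff leaf_neq_stem by metis+
  then show ?thesis using assms in_verts unfolding complement_edge_set_def by blast
qed

section \<open>Critical pairs of added edges and 4-cycles\<close>

text \<open>By \<open>meet\<close>, adding both edges lowers the stability number. The set of all
  leaves must contain one of them, and \<open>e1_leaves\<close> fixes which one.\<close>

lemma four_cycle_if_no_avoiding_set:
  assumes e1: "e1 \<in> complement_edge_set G" and e2: "e2 \<in> complement_edge_set G"
    and meet: "\<And>S. stable_set G S \<Longrightarrow> card S = card M \<Longrightarrow> e1 \<subseteq> S \<or> e2 \<subseteq> S"
    and e1_leaves: "e1 \<subseteq> exchange {}"
  shows "\<exists>a b c d. distinct [a, b, c, d] \<and> {(a, b), (b, c), (c, d), (d, a)} \<subseteq> parcs G"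
proof -
  have pair: "\<exists>a b. a \<in> M \<and> b \<in> M \<and> a \<noteq> b \<and> e = {leaf a, leaf b}"
    if e: "e \<in> complement_edge_set G" "e \<subseteq> leaf ` M" for e
  proof -
    from e(1) obtain u v where "e = {u, v}" "u \<noteq> v" by (auto simp: complement_edge_set_def)
    with e(2) show ?thesis by auto
  qed
  have meet_exchange: "e1 \<subseteq> exchange A \<or> e2 \<subseteq> exchange A"
    if "A \<subseteq> M" "\<And>a b. a \<in> A \<Longrightarrow> b \<in> A \<Longrightarrow> (stem a, stem b) \<notin> parcs G" for A
    using meet that stable_set_exchange card_exchange by blast
  from pair[OF e1] e1_leaves obtain a b where
    ab: "a \<in> M" "b \<in> M" "a \<noteq> b" "e1 = {leaf a, leaf b}"
    by (auto simp: exchange_def)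
  \<comment> \<open>Exchanging at \<open>x\<close> removes \<open>leaf x\<close>, an element of
    \<open>e1\<close>, so \<open>e2\<close> has to be the contained pair.\<close>
  have e2_sub: "e2 \<subseteq> exchange {x}" if "x \<in> {a, b}" for x
    using meet_exchange[of "{x}"] that ab leaf_in_exchange_iff[of "{x}" x] no_loop by auto
  have "stem a \<notin> exchange {b}"
    using ab stem_in_exchange_iff[of "{b}" a] by simp
  \<comment> \<open>The only stem in \<open>exchange {a}\<close> is \<open>stem a\<close>, and
    \<open>exchange {b}\<close> rules it out.\<close>
  then have "e2 \<subseteq> leaf ` M"
    using e2_sub[of a] e2_sub[of b] by (auto simp: exchange_def)
  from pair[OF e2 this] obtain c d where
    cd: "c \<in> M" "d \<in> M" "c \<noteq> d" "e2 = {leaf c, leaf d}"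
    by blast
  \<comment> \<open>\<open>leaf y\<close> belongs to \<open>e2\<close> and hence to
    \<open>exchange {x}\<close>, whereas \<open>leaf x\<close> does not.\<close>
  have disj: "x \<noteq> y" if "x \<in> {a, b}" "y \<in> {c, d}" for x y
    using that e2_sub[OF that(1)] leaf_in_exchange_iff[of "{x}" x] ab cd by auto
  have adj: "(stem x, stem y) \<in> parcs G" if "x \<in> {a, b}" "y \<in> {c, d}" for x y
  proof (rule ccontr)
    \<comment> \<open>Non-adjacent stems would make \<open>exchange {x, y}\<close> a maximum stable
      set; it lacks \<open>leaf x\<close> from \<open>e1\<close> and \<open>leaf y\<close> from
      \<open>e2\<close>, against \<open>meet\<close>.\<close>
    assume "(stem x, stem y) \<notin> parcs G"
    moreover from this have "(stem y, stem x) \<notin> parcs G" using arc_sym by blast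
    moreover have "{x, y} \<subseteq> M" using that ab cd by auto
    ultimately have "e1 \<subseteq> exchange {x, y} \<or> e2 \<subseteq> exchange {x, y}"
      using meet_exchange[of "{x, y}"] no_loop by auto
    then show False
      using that ab(4) cd(4) \<open>{x, y} \<subseteq> M\<close>
        leaf_in_exchange_iff[of "{x, y}" x] leaf_in_exchange_iff[of "{x, y}" y]
      by auto
  qed
  have "distinct [stem a, stem c, stem b, stem d]"
    using ab cd disj[of a c] disj[of a d] disj[of b c] disj[of b d] by (simp add: stem_eq_iff)
  moreover have "{(stem a, stem c), (stem c, stem b), (stem b, stem d), (stem d, stem a)} \<subseteq> parcs G"
    using adj arc_sym by auto
  ultimately show ?thesis by blast
qed

text \<open>A leaf has just one neighbour, so a vertex with two is the stem of its matching edge.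
  This applies to every vertex of a 4-cycle.\<close>

lemma stem_of_branch_vertex:
  assumes "(v, x) \<in> parcs G" "(v, y) \<in> parcs G" "x \<noteq> y"
  shows "\<exists>e\<in>M. v = stem e"
proof -
  have "v \<in> pverts G" using assms(1) by (auto dest: in_arcsD1)
  then obtain e where e: "e \<in> M" "v \<in> e" using cover by blast
  moreover have "v \<noteq> leaf e" using e(1) assms leaf_neighbour_iff by metis
  ultimately show ?thesis using edge_eq by blast
qed

lemma not_alpha_plus_plus_stable_if_four_cycle:
  assumes "distinct [u, v, w, x]" "{(u, v), (v, w), (w, x), (x, u)} \<subseteq> parcs G"
  shows "\<not> alpha_plus_plus_stable G"
proof
  assume stable: "alpha_plus_plus_stable G"
  have arcs: "(u, v) \<in> parcs G" "(v, u) \<in> parcs G" "(v, w) \<in> parcs G" "(w, v) \<in> parcs G"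
    "(w, x) \<in> parcs G" "(x, w) \<in> parcs G" "(x, u) \<in> parcs G" "(u, x) \<in> parcs G"
    using assms(2) arc_sym by auto
  \<comment> \<open>The matching edges \<open>a\<close>, \<open>b\<close> belong to one pair of
    opposite cycle vertices, \<open>c\<close>, \<open>d\<close> to the other; the edges to be added
    join the leaves within each pair.\<close>
  obtain a where a: "a \<in> M" "u = stem a" using stem_of_branch_vertex[of u v x] arcs assms(1) by auto
  obtain b where b: "b \<in> M" "w = stem b" using stem_of_branch_vertex[of w v x] arcs assms(1) by auto
  obtain c where c: "c \<in> M" "v = stem c" using stem_of_branch_vertex[of v u w] arcs assms(1) by auto
  obtain d where d: "d \<in> M" "x = stem d" using stem_of_branch_vertex[of x u w] arcs assms(1) by auto
  have "a \<noteq> b" "c \<noteq> d" using assms(1) a b c d by auto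
  then have compl: "{leaf a, leaf b} \<in> complement_edge_set G" "{leaf c, leaf d} \<in> complement_edge_set G"
    using leaf_pair_complement_edge a b c d by auto
  then obtain S where S: "stable_set G S" "card S = card M"
      "\<not> {leaf a, leaf b} \<subseteq> S" "\<not> {leaf c, leaf d} \<subseteq> S"
    using stable stability_number_add_two_edges_iff[OF compl]
    unfolding alpha_plus_plus_stable_def by blast
  \<comment> \<open>A maximum stable set contains the stem wherever it misses the leaf. Each of
    \<open>u\<close>, \<open>w\<close> is adjacent to each of \<open>v\<close>, \<open>x\<close>,
    which contradicts stability.\<close>
  have "u \<in> S \<or> w \<in> S" "v \<in> S \<or> x \<in> S"
    using S a b c d card_stable_set_eq_iff[OF S(1)] by auto
  then show False using S(1) arcs by (auto simp: stable_set_def)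
qed

lemma alpha_plus_plus_stable_iff:
  "alpha_plus_plus_stable G \<longleftrightarrow>
    \<not> (\<exists>a b c d. distinct [a, b, c, d] \<and> {(a, b), (b, c), (c, d), (d, a)} \<subseteq> parcs G)"
    (is "_ \<longleftrightarrow> \<not> ?C4")
proof
  show "alpha_plus_plus_stable G \<Longrightarrow> \<not> ?C4"
    using not_alpha_plus_plus_stable_if_four_cycle by blast
next
  assume no: "\<not> ?C4"
  show "alpha_plus_plus_stable G"
    unfolding alpha_plus_plus_stable_def
  proof (intro ballI, rule ccontr)
    fix e1 e2 assume e: "e1 \<in> complement_edge_set G" "e2 \<in> complement_edge_set G"
      "stability_number (add_edge (add_edge G e1) e2) \<noteq> stability_number G"
    then have meet: "e1 \<subseteq> S \<or> e2 \<subseteq> S" if "stable_set G S" "card S = card M" for S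
      using that stability_number_add_two_edges_iff by blast
    \<comment> \<open>The set of all leaves decides which added edge plays the first role; the other
      hypotheses are symmetric in the two.\<close>
    then have "e1 \<subseteq> exchange {} \<or> e2 \<subseteq> exchange {}"
      using stable_set_exchange[of "{}"] card_exchange[of "{}"] by blast
    then show False
    proof
      assume "e1 \<subseteq> exchange {}"
      with four_cycle_if_no_avoiding_set[OF e(1,2)] meet no show False by blast
    next
      assume "e2 \<subseteq> exchange {}"
      with four_cycle_if_no_avoiding_set[OF e(2,1)] meet no show False by blast
    qed
  qed
qed

end

text \<open>In each matching edge a degree-1 endpoint is chosen as \<open>leaf\<close>; its single
  neighbour must be the other endpoint.\<close>

lemma pendant_matchingI:
  assumes "pair_graph G" "perfect_matching G M" "\<forall>e\<in>M. pendant_edge G e"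
  shows "\<exists>leaf stem. pendant_matching G M leaf stem"
proof -
  interpret pair_graph G by fact
  have "\<exists>l s. e = {l, s} \<and> (\<forall>w. (l, w) \<in> parcs G \<longleftrightarrow> w = s)" if "e \<in> M" for e
  proof -
    from assms(3) that obtain l where e: "e \<in> edge_set G" "l \<in> e" "card (neighbours G l) = 1"
      by (auto simp: pendant_edge_def)
    \<comment> \<open>The arc witnessing that \<open>e\<close> is an edge may start at either
      endpoint; symmetry turns it to start at \<open>l\<close>.\<close>
    from e(1,2) obtain s where s: "e = {l, s}" "(l, s) \<in> parcs G"
      using arcs_symmetric unfolding edge_set_def by blast
    from e(3) obtain t where "neighbours G l = {t}" by (auto simp: card_1_singleton_iff)
    with s(2) have "(l, w) \<in> parcs G \<longleftrightarrow> w = s" for w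
      unfolding neighbours_def by (metis mem_Collect_eq singletonD)
    with s(1) show ?thesis by blast
  qed
  then obtain leaf stem where
    "\<forall>e\<in>M. e = {leaf e, stem e} \<and> (\<forall>w. (leaf e, w) \<in> parcs G \<longleftrightarrow> w = stem e)"
    by metis
  then have "pendant_matching G M leaf stem"
    using assms(2) by unfold_locales (auto simp: perfect_matching_def)
  then show ?thesis by blast
qed

theorem theorem4:
  fixes G :: "'a pair_pre_digraph"
  assumes "pair_graph G"
    and "card (pverts G) \<ge> 2"
    and "\<exists>M. perfect_matching G M \<and> (\<forall>e\<in>M. pendant_edge G e)"
  shows "alpha_plus_plus_stable G \<longleftrightarrow> \<not> has_cycle_of_length G 4"
proof -
  obtain M leaf stem where "pendant_matching G M leaf stem"
    using assms(1,3) pendant_matchingI by blast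
  then show ?thesis
    using pendant_matching.alpha_plus_plus_stable_iff has_cycle_of_length_4_iff[OF assms(1)] by metis
qed

end
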